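(* Let $X$ be a Banach space and let $L$ be the infinitesimal generator of a uniformly bounded $C_0$-semigroup $\{e^{tL}\}_{t\ge0}$ on $X$. Assume that $0\in\rho(L)$. Fix $s>0$ noninteger, with integer part $[s]$, and let $u_m,v_m\in X$ for $0\le m\le[s]$. Then the $(2[s]+2)$-order initial value extension problem $$\begin{cases}\big(L+\frac{1-2(s-[s])}{y}\partial_y+\partial_{yy}\big)^{[s]+1}U=0 & \text{for } y>0\\ \lim_{y\to0}\big(L+\frac{1-2(s-[s])}{y}\partial_y+\partial_{yy}\big)^mU=u_m & \text{in } X,\ 0\le m\le[s]\\ \lim_{y\to0}y^{1-2(s-[s])}\partial_y\big(L+\frac{1-2(s-[s])}{y}\partial_y+\partial_{yy}\big)^mU=v_m & \text{in } X,\ 0\le m\le[s]\end{cases}$$ has at most one classical solution, and the second order extension problem with $(2[s]+2)$ initial conditions $$\begin{cases}LU+\frac{1-2s}{y}\partial_yU+\partial_{yy}U=0 & \text{for } y>0\\ \lim_{y\to0}\big(\frac2y\partial_y\big)^mU=u_m & \text{in } X,\ 0\le m\le[s]\\ \lim_{y\to0}y^{1-2(s-[s])}\partial_y\big(\frac2y\partial_y\big)^mU=v_m & \text{in } X,\ 0\le m\le[s]\end{cases}$$ has at most one classical solution.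
   Context: A $C_0$-semigroup $\{e^{tL}\}_{t\ge0}$ is uniformly bounded if there is $M\ge1$ with $\|e^{tL}\|\le M$ for all $t\ge0$. $\rho(L)$ is the resolvent set of $L$; $D(L^k)$ is the domain of $L^k$ with the graph norm. A classical solution is a function $U(y)$ that is as continuously differentiable in $(0,\infty)$ as the equation (and the expressions in the initial conditions) requires, with values in the corresponding domains of $L$ and integer powers of $L$, and whose initial conditions are satisfied with continuity up to $y=0$. Concretely, for the equation $(L+\frac ay\partial_y+\partial_{yy})^{N}U=0$ this means $U\in C^{2(N-k)}((0,\infty);D(L^k))$ for $0\le k\le N$, and the limits as $y\to0$ in the initial conditions exist in $X$ and have the prescribed values; if the initial conditions contain higher $y$-derivatives of $U$, these are assumed to exist and be continuous on $(0,\infty)$. *)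

theory Defs
  imports "HOL-Analysis.Analysis"
begin

text \<open>
  Scalars are real. A complex Banach space is covered by restriction of scalars, which changes
  neither the semigroup nor its generator, and does not affect whether the scalar 0 belongs to
  the resolvent set.
\<close>

definition C0_semigroup :: "(real \<Rightarrow> 'a::banach \<Rightarrow>\<^sub>L 'a) \<Rightarrow> bool" where
  "C0_semigroup T \<longleftrightarrow>
     T 0 = id_blinfun \<and>
     (\<forall>r\<ge>0. \<forall>t\<ge>0. T (r + t) = T r o\<^sub>L T t) \<and>
     (\<forall>x. ((\<lambda>t. blinfun_apply (T t) x) \<longlongrightarrow> x) (at_right 0))"

definition uniformly_bounded_semigroup :: "(real \<Rightarrow> 'a::banach \<Rightarrow>\<^sub>L 'a) \<Rightarrow> bool" where
  "uniformly_bounded_semigroup T \<longleftrightarrow> (\<exists>M\<ge>1. \<forall>t\<ge>0. norm (T t) \<le> M)"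

text \<open>
  An unbounded operator is given by its domain \<open>D\<close> and a total function \<open>L\<close> whose values
  outside \<open>D\<close> are arbitrary.
\<close>

definition is_generator ::
    "'a set \<Rightarrow> ('a \<Rightarrow> 'a) \<Rightarrow> (real \<Rightarrow> 'a::banach \<Rightarrow>\<^sub>L 'a) \<Rightarrow> bool" where
  "is_generator D L T \<longleftrightarrow>
     D = {x. \<exists>l. ((\<lambda>t. (blinfun_apply (T t) x - x) /\<^sub>R t) \<longlongrightarrow> l) (at_right 0)} \<and>
     (\<forall>x\<in>D. ((\<lambda>t. (blinfun_apply (T t) x - x) /\<^sub>R t) \<longlongrightarrow> L x) (at_right 0))"

definition resolvent_set :: "'a::banach set \<Rightarrow> ('a \<Rightarrow> 'a) \<Rightarrow> real set" where
  "resolvent_set D L =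
     {r. bij_betw (\<lambda>x. r *\<^sub>R x - L x) D UNIV \<and>
         bounded_linear (inv_into D (\<lambda>x. r *\<^sub>R x - L x))}"

primrec dom_pow :: "'a set \<Rightarrow> ('a \<Rightarrow> 'a) \<Rightarrow> nat \<Rightarrow> 'a set" where
  "dom_pow D L 0 = UNIV"
| "dom_pow D L (Suc k) = {x \<in> D. L x \<in> dom_pow D L k}"

definition graph_norm :: "('a \<Rightarrow> 'a) \<Rightarrow> nat \<Rightarrow> 'a::real_normed_vector \<Rightarrow> real" where
  "graph_norm L k x = norm x + norm ((L ^^ k) x)"

text \<open>
  \<open>U\<close> belongs to the space of \<open>n\<close> times continuously differentiable functions from the open
  half-line to the domain of the \<open>k\<close>-th power of \<open>L\<close>: \<open>V j\<close> is the \<open>j\<close>-th derivative, and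
  difference quotients and continuity are taken in the graph norm.
\<close>

definition C_into_dom_pow ::
    "nat \<Rightarrow> 'a::real_normed_vector set \<Rightarrow> ('a \<Rightarrow> 'a) \<Rightarrow> nat \<Rightarrow> (real \<Rightarrow> 'a) \<Rightarrow> bool" where
  "C_into_dom_pow n D L k U \<longleftrightarrow>
     (\<exists>V :: nat \<Rightarrow> real \<Rightarrow> 'a.
        (\<forall>y>0. V 0 y = U y) \<and>
        (\<forall>j\<le>n. \<forall>y>0. V j y \<in> dom_pow D L k) \<and>
        (\<forall>j<n. \<forall>y>0.
           ((\<lambda>z. graph_norm L k ((V j z - V j y) /\<^sub>R (z - y) - V (Suc j) y)) \<longlongrightarrow> 0) (at y)) \<and>
        (\<forall>y>0. ((\<lambda>z. graph_norm L k (V n z - V n y)) \<longlongrightarrow> 0) (at y)))"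

definition dy :: "(real \<Rightarrow> 'a::real_normed_vector) \<Rightarrow> real \<Rightarrow> 'a" where
  "dy U = (\<lambda>y. vector_derivative U (at y))"

definition ext_op ::
    "('a \<Rightarrow> 'a) \<Rightarrow> real \<Rightarrow> (real \<Rightarrow> 'a::real_normed_vector) \<Rightarrow> real \<Rightarrow> 'a" where
  "ext_op L a U = (\<lambda>y. L (U y) + (a / y) *\<^sub>R dy U y + dy (dy U) y)"

definition two_over_y_dy :: "(real \<Rightarrow> 'a::real_normed_vector) \<Rightarrow> real \<Rightarrow> 'a" where
  "two_over_y_dy U = (\<lambda>y. (2 / y) *\<^sub>R dy U y)"

definition regular_for_order ::
    "nat \<Rightarrow> 'a::real_normed_vector set \<Rightarrow> ('a \<Rightarrow> 'a) \<Rightarrow> (real \<Rightarrow> 'a) \<Rightarrow> bool" where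
  "regular_for_order N D L U \<longleftrightarrow> (\<forall>k\<le>N. C_into_dom_pow (2 * (N - k)) D L k U)"

text \<open>
  The regularity below covers all \<open>y\<close>-derivatives occurring in the initial conditions, whose
  order is at most \<open>2 * n + 1\<close>.
\<close>

definition classical_solution_higher_order ::
    "'a::banach set \<Rightarrow> ('a \<Rightarrow> 'a) \<Rightarrow> real \<Rightarrow> (nat \<Rightarrow> 'a) \<Rightarrow> (nat \<Rightarrow> 'a) \<Rightarrow> (real \<Rightarrow> 'a) \<Rightarrow> bool" where
  "classical_solution_higher_order D L s u v U \<longleftrightarrow>
     (let n = nat \<lfloor>s\<rfloor>; a = 1 - 2 * (s - real n) in
        regular_for_order (n + 1) D L U \<and>
        (\<forall>y>0. (ext_op L a ^^ (n + 1)) U y = 0) \<and>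
        (\<forall>m\<le>n. ((ext_op L a ^^ m) U \<longlongrightarrow> u m) (at_right 0)) \<and>
        (\<forall>m\<le>n. ((\<lambda>y. (y powr a) *\<^sub>R dy ((ext_op L a ^^ m) U) y) \<longlongrightarrow> v m) (at_right 0)))"

text \<open>
  Here the initial conditions contain \<open>y\<close>-derivatives of order up to \<open>n + 1\<close>, which may exceed
  the order 2 of the equation; hence the additional regularity with values in the whole space
  (the domain of the zeroth power).
\<close>

definition classical_solution_second_order ::
    "'a::banach set \<Rightarrow> ('a \<Rightarrow> 'a) \<Rightarrow> real \<Rightarrow> (nat \<Rightarrow> 'a) \<Rightarrow> (nat \<Rightarrow> 'a) \<Rightarrow> (real \<Rightarrow> 'a) \<Rightarrow> bool" where
  "classical_solution_second_order D L s u v U \<longleftrightarrow>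
     (let n = nat \<lfloor>s\<rfloor> in
        regular_for_order 1 D L U \<and>
        C_into_dom_pow (n + 1) D L 0 U \<and>
        (\<forall>y>0. ext_op L (1 - 2 * s) U y = 0) \<and>
        (\<forall>m\<le>n. ((two_over_y_dy ^^ m) U \<longlongrightarrow> u m) (at_right 0)) \<and>
        (\<forall>m\<le>n. ((\<lambda>y. (y powr (1 - 2 * (s - real n))) *\<^sub>R dy ((two_over_y_dy ^^ m) U) y)
                  \<longlongrightarrow> v m) (at_right 0)))"

end

theory Submission
  imports Defs "HOL-Real_Asymp.Real_Asymp"
begin

text \<open>
  Formally, a solution with zero initial data equals the \<open>k\<close>-th iterate of the inverse Bessel
  operator applied to \<open>(-L)\<^sup>k U\<close>, and the iterated inverse contributes a factor of order
  \<open>y\<^bsup>2k\<^esup> / (4\<^sup>k (k!)\<^sup>2)\<close>. The powers of \<open>L\<close> are tamed by first averaging \<open>U\<close> along the semigroup over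
  intervals of lengths \<open>h\<^sub>1, \<dots>, h\<^sub>k\<close>: each average absorbs one \<open>L\<close> at the cost of a factor \<open>(1 + M) / h\<^sub>j\<close>,
  and all averages together move \<open>U\<close> by at most a constant times \<open>\<Sum> h\<^sub>j\<close>. Lengths like \<open>(J + j)\<^bsup>-3/2\<^esup>\<close>
  make the first cost negligible against \<open>(k!)\<^sup>2\<close> as \<open>k\<close> grows and then the second one small as \<open>J\<close>
  grows, so \<open>U = 0\<close>. No growth condition on \<open>U\<close> at infinity is involved.

  The problem of higher order reduces to this case by treating \<open>(L + a/y \<partial>\<^sub>y + \<partial>\<^sub>y\<^sub>y)\<^sup>m U\<close> for
  decreasing \<open>m\<close>. In the second problem \<open>(2/y \<partial>\<^sub>y)\<^sup>m U\<close> solves the equation with \<open>s - m\<close> in place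
  of \<open>s\<close>, so that \<open>m = [s]\<close> leads to the same case.
\<close>

section \<open>Weighted integration estimates for the Bessel operator\<close>

lemma norm_le_of_vector_derivative_powr:
  fixes f f' :: "real \<Rightarrow> 'a::real_normed_vector"
  assumes deriv: "\<And>t. 0 < t \<Longrightarrow> t \<le> b \<Longrightarrow> (f has_vector_derivative f' t) (at t)"
    and bound: "\<And>t. 0 < t \<Longrightarrow> t \<le> b \<Longrightarrow> norm (f' t) \<le> c * t powr q"
    and q: "q > -1" and c: "c \<ge> 0" and lim: "(f \<longlongrightarrow> 0) (at_right 0)"
    and y: "0 < y" "y \<le> b"
  shows "norm (f y) \<le> c / (q + 1) * y powr (q + 1)"
proof -
  define g where "g = (\<lambda>t::real. c / (q + 1) * t powr (q + 1))"
  have g: "(g has_vector_derivative c * t powr q) (at t)" if "t > 0" for t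
    unfolding g_def using that q
    by (auto intro!: derivative_eq_intros simp: has_real_derivative_iff_has_vector_derivative[symmetric])
  \<comment> \<open>Mean value inequality on \<open>[x, y]\<close> with majorant \<open>g\<close>;
    afterwards \<open>x\<close> tends to 0, where \<open>f\<close> vanishes.\<close>
  have *: "norm (f y - f x) \<le> g y" if "0 < x" "x < y" for x
  proof -
    have "norm (f y - f x) \<le> g y - g x"
    proof (rule differentiable_bound_general[OF that(2), where f' = f' and \<phi>' = "\<lambda>t. c * t powr q"])
      show "continuous_on {x..y} f"
        using that y
        by (intro continuous_on_vector_derivative[where f' = f'] has_vector_derivative_at_within[OF deriv]) auto
      show "continuous_on {x..y} g"
        using that
        by (intro continuous_on_vector_derivative[where f' = "\<lambda>t. c * t powr q"] has_vector_derivative_at_within[OF g]) auto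
    qed (use deriv g bound that y in auto)
    moreover have "g x \<ge> 0" using c q by (auto simp: g_def)
    ultimately show ?thesis by linarith
  qed
  have "((\<lambda>x. norm (f y - f x)) \<longlongrightarrow> norm (f y - 0)) (at_right 0)"
    by (intro tendsto_intros lim)
  moreover have "\<forall>\<^sub>F x in at_right 0. norm (f y - f x) \<le> g y"
    using * y by (auto simp: eventually_at_right_field)
  ultimately show ?thesis
    using tendsto_upperbound[of _ "norm (f y - 0)"] by (force simp: g_def)
qed

text \<open>The weight \<open>t powr a\<close> turns the Bessel expression into the derivative of
  the weighted \<open>V1\<close>. So the previous estimate applies twice: to this weighted
  derivative with exponent \<open>q + a > -1\<close>, and, after division by the weight, to
  \<open>V\<close> with exponent \<open>q + 1\<close>.\<close>

lemma bessel_norm_le: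
  fixes V V1 V2 :: "real \<Rightarrow> 'a::real_normed_vector"
  assumes V1: "\<And>t. t > 0 \<Longrightarrow> (V has_vector_derivative V1 t) (at t)"
    and V2: "\<And>t. t > 0 \<Longrightarrow> (V1 has_vector_derivative V2 t) (at t)"
    and bound: "\<And>t. 0 < t \<Longrightarrow> t \<le> b \<Longrightarrow> norm (V2 t + (a / t) *\<^sub>R V1 t) \<le> c * t powr q"
    and q: "q \<ge> 0" and a: "a > -1" and c: "c \<ge> 0"
    and lim: "(V \<longlongrightarrow> 0) (at_right 0)" "((\<lambda>t. (t powr a) *\<^sub>R V1 t) \<longlongrightarrow> 0) (at_right 0)"
    and y: "0 < y" "y \<le> b"
  shows "norm (V y) \<le> c / ((q + 2) * (q + 1 + a)) * y powr (q + 2)"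
proof -
  have 1: "norm ((t powr a) *\<^sub>R V1 t) \<le> c / (q + a + 1) * t powr (q + a + 1)" if "0 < t" "t \<le> b" for t
  proof (rule norm_le_of_vector_derivative_powr[OF _ _ _ c lim(2) that])
    fix r :: real assume r: "0 < r" "r \<le> b"
    show "((\<lambda>t. (t powr a) *\<^sub>R V1 t) has_vector_derivative (r powr a) *\<^sub>R (V2 r + (a / r) *\<^sub>R V1 r)) (at r)"
      using r by (auto intro!: derivative_eq_intros V2 simp: powr_diff algebra_simps)
    show "norm ((r powr a) *\<^sub>R (V2 r + (a / r) *\<^sub>R V1 r)) \<le> c * r powr (q + a)"
      using mult_left_mono[OF bound[OF r], of "r powr a"] by (simp add: powr_add mult_ac)
  qed (use q a in auto)
  have 2: "norm (V1 t) \<le> c / (q + a + 1) * t powr (q + 1)" if "0 < t" "t \<le> b" for t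
  proof -
    have "t powr a * norm (V1 t) \<le> t powr a * (c / (q + a + 1) * t powr (q + 1))"
      using 1[OF that] by (simp add: powr_add mult_ac)
    thus ?thesis using that by (subst (asm) mult_le_cancel_left_pos) auto
  qed
  have "norm (V y) \<le> (c / (q + a + 1)) / (q + 1 + 1) * y powr (q + 1 + 1)"
    by (rule norm_le_of_vector_derivative_powr[OF V1 2 _ _ lim(1) y]) (use q a c in auto)
  thus ?thesis by (simp add: field_simps)
qed

text \<open>Once the factors are below 1/2 in size, the products are summable by the ratio
  test.\<close>

lemma prod_tendsto_zero:
  fixes r :: "nat \<Rightarrow> real"
  assumes "r \<longlonglongrightarrow> 0"
  shows "(\<lambda>k. \<Prod>p<k. r p) \<longlonglongrightarrow> 0"
proof -
  have "\<forall>\<^sub>F p in sequentially. norm (r p) < 1/2"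
    using order_tendstoD(2)[OF tendsto_norm_zero[OF assms], of "1/2"] by simp
  then obtain N where N: "\<And>p. p \<ge> N \<Longrightarrow> norm (r p) < 1/2"
    by (auto simp: eventually_sequentially)
  have "summable (\<lambda>k. \<Prod>p<k. r p)"
  proof (rule summable_ratio_test[of "1/2" N])
    fix n assume "n \<ge> N"
    then show "norm (\<Prod>p<Suc n. r p) \<le> 1/2 * norm (\<Prod>p<n. r p)"
      using mult_left_mono[of "norm (r n)" "1/2" "norm (\<Prod>p<n. r p)"] N[of n]
      by (simp add: abs_mult mult.commute)
  qed simp
  thus ?thesis by (rule summable_LIMSEQ_zero)
qed

lemma bounded_linear_blinfun_funpow:
  fixes B :: "'a::real_normed_vector \<Rightarrow>\<^sub>L 'a"
  shows "bounded_linear (blinfun_apply B ^^ k)"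
proof (induction k)
  case (Suc k)
  have "bounded_linear (\<lambda>x. B ((blinfun_apply B ^^ k) x))"
    by (rule bounded_linear_compose[OF blinfun.bounded_linear_right Suc])
  thus ?case by (simp add: comp_def)
qed (simp add: id_def)

section \<open>Averages along a bounded semigroup\<close>

text \<open>\<open>A\<close> stands for the inverse of the negative generator. The generator itself
  enters only through \<open>A_generator\<close>, by which it sends \<open>A x\<close> to
  \<open>- x\<close>, so that all computations involve bounded operators.\<close>

locale bounded_semigroup =
  fixes T :: "real \<Rightarrow> 'a::banach \<Rightarrow>\<^sub>L 'a" and A :: "'a \<Rightarrow>\<^sub>L 'a" and M :: real
  assumes T_0: "T 0 = id_blinfun"
    and T_add: "r \<ge> 0 \<Longrightarrow> t \<ge> 0 \<Longrightarrow> T (r + t) = T r o\<^sub>L T t"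
    and T_norm: "t \<ge> 0 \<Longrightarrow> norm (T t) \<le> M"
    and T_A: "t \<ge> 0 \<Longrightarrow> T t (A x) = A (T t x)"
    and A_generator: "((\<lambda>t. (T t (A x) - A x) /\<^sub>R t) \<longlongrightarrow> - x) (at_right 0)"
begin

text \<open>The sign is opposite to the usual one: for small \<open>h\<close> this approximates the
  inverse of \<open>A\<close>.\<close>

definition diffq :: "real \<Rightarrow> 'a \<Rightarrow>\<^sub>L 'a" where
  "diffq h = (1 / h) *\<^sub>R (id_blinfun - T h)"

lemma diffq_apply: "diffq h x = (1 / h) *\<^sub>R (x - T h x)"
  by (simp add: diffq_def blinfun.bilinear_simps)

lemma T_apply_add: "r \<ge> 0 \<Longrightarrow> t \<ge> 0 \<Longrightarrow> T r (T t x) = T (r + t) x"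
  by (simp add: T_add)

lemma T_apply_norm: "t \<ge> 0 \<Longrightarrow> norm (T t x) \<le> M * norm x"
  using norm_blinfun[of "T t" x] T_norm[of t] by (meson mult_right_mono norm_ge_zero order_trans)

lemma M_nonneg: "M \<ge> 0"
  using T_norm[of 0] norm_ge_zero order_trans by blast

lemma diffq_norm: assumes "h > 0" shows "norm (diffq h) \<le> (1 + M) / h"
proof -
  have "norm (id_blinfun - T h) \<le> norm (id_blinfun :: 'a \<Rightarrow>\<^sub>L 'a) + norm (T h)" by (rule norm_triangle_ineq4)
  also have "\<dots> \<le> 1 + M"
    using T_norm[of h] assms norm_blinfun_id_le[where 'a='a] by linarith
  finally show ?thesis using assms by (simp add: diffq_def divide_right_mono)
qed

text \<open>\<open>diffq h (A z)\<close> is the mean of \<open>T r z\<close> over \<open>r \<in> [0, h]\<close>; a telescoping sum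
  replaces the integral.\<close>

lemma diffq_A_norm_le:
  assumes h: "h > 0" and t: "t \<ge> 0"
    and K: "\<And>r. t \<le> r \<Longrightarrow> r \<le> t + h \<Longrightarrow> norm (T r z - w) \<le> K"
  shows "norm (T t (diffq h (A z)) - w) \<le> K"
proof -
  \<comment> \<open>A grid of \<open>Suc N\<close> intervals on \<open>[0, h]\<close>; the successor
    keeps their number positive.\<close>
  define d where "d N = h / real (Suc N)" for N
  have d: "d N > 0" for N using h by (simp add: d_def)
  \<comment> \<open>The error with which the quotient of step \<open>d N\<close> at
    \<open>A z\<close> reproduces \<open>z\<close>; it tends to 0 by
    \<open>A_generator\<close>.\<close>
  define e where "e N = diffq (d N) (A z) - z" for N
  have "filterlim d (at_right 0) sequentially"
  proof -
    have "d \<longlonglongrightarrow> 0"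
      unfolding d_def by (rule LIMSEQ_Suc[OF lim_const_over_n])
    moreover have "d N \<noteq> 0" for N using d[of N] by simp
    ultimately show ?thesis unfolding filterlim_at using d by (auto simp: less_imp_le)
  qed
  hence "(\<lambda>N. (T (d N) (A z) - A z) /\<^sub>R d N) \<longlonglongrightarrow> - z"
    using A_generator filterlim_compose by blast
  hence "(\<lambda>N. - ((T (d N) (A z) - A z) /\<^sub>R d N) - z) \<longlonglongrightarrow> - (- z) - z"
    by (intro tendsto_intros)
  moreover have "- ((T (d N) (A z) - A z) /\<^sub>R d N) - z = e N" for N
    by (simp add: e_def diffq_apply scaleR_diff_right divide_inverse)
  ultimately have e: "e \<longlonglongrightarrow> 0" by simp
  have main: "norm (T t (diffq h (A z)) - w) \<le> K + M * norm (e N)" for N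
  proof -
    \<comment> \<open>Samples of the orbit of \<open>A z\<close> on the grid. Each decrement is
      \<open>d N\<close> times the orbit of \<open>z + e N\<close>, so \<open>diffq h (A z)\<close>
      becomes a Riemann sum of the orbit of \<open>z\<close> up to this error.\<close>
    define x where "x i = T (t + real i * d N) (A z)" for i
    have x: "x i - x (Suc i) = d N *\<^sub>R (T (t + real i * d N) (z + e N))" for i
    proof -
      have "x (Suc i) = T (t + real i * d N) (T (d N) (A z))"
        using t d[of N] by (subst T_apply_add) (auto simp: x_def algebra_simps)
      hence "x i - x (Suc i) = T (t + real i * d N) (A z - T (d N) (A z))"
        by (simp add: x_def blinfun.diff_right)
      also have "A z - T (d N) (A z) = d N *\<^sub>R (z + e N)"
        using d[of N] by (simp add: e_def diffq_apply)
      finally show ?thesis by (simp add: blinfun.scaleR_right)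
    qed
    have "T t (diffq h (A z)) = (1 / h) *\<^sub>R (x 0 - x (Suc N))"
      using h t by (simp add: diffq_apply blinfun.bilinear_simps x_def d_def T_apply_add)
    also have "x 0 - x (Suc N) = (\<Sum>i<Suc N. x i - x (Suc i))"
      by (rule sum_lessThan_telescope'[symmetric])
    also have "\<dots> = d N *\<^sub>R (\<Sum>i<Suc N. T (t + real i * d N) (z + e N))"
      unfolding x by (rule scaleR_sum_right[symmetric])
    finally have "T t (diffq h (A z)) - w
        = (1 / real (Suc N)) *\<^sub>R (\<Sum>i<Suc N. T (t + real i * d N) (z + e N)) - w"
      using h by (simp add: d_def del: sum.lessThan_Suc of_nat_Suc)
    also have "\<dots> = (1 / real (Suc N)) *\<^sub>R (\<Sum>i<Suc N. T (t + real i * d N) (z + e N) - w)"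
      by (simp add: sum_subtractf sum_constant_scaleR scaleR_diff_right del: sum.lessThan_Suc of_nat_Suc)
    finally have "norm (T t (diffq h (A z)) - w)
        = (1 / real (Suc N)) * norm (\<Sum>i<Suc N. T (t + real i * d N) (z + e N) - w)" by simp
    also have "\<dots> \<le> (1 / real (Suc N)) * (real (Suc N) * (K + M * norm (e N)))"
    proof (intro mult_left_mono, rule order_trans[OF sum_norm_bound])
      fix i assume i: "i \<in> {..<Suc N}"
      have "real i * d N \<le> real (Suc N) * d N" using i d[of N] by (intro mult_right_mono) auto
      hence r: "real i * d N \<le> h" by (simp add: d_def)
      have "T (t + real i * d N) (z + e N) - w
          = (T (t + real i * d N) z - w) + T (t + real i * d N) (e N)"
        by (simp add: blinfun.add_right)
      also have "norm \<dots> \<le> K + M * norm (e N)"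
        using r t d[of N] by (intro norm_triangle_mono K T_apply_norm) auto
      finally show "norm (T (t + real i * d N) (z + e N) - w) \<le> K + M * norm (e N)" .
    qed (auto simp del: sum.lessThan_Suc of_nat_Suc)
    also have "\<dots> = K + M * norm (e N)" by (simp del: of_nat_Suc)
    finally show ?thesis .
  qed
  have "(\<lambda>N. K + M * norm (e N)) \<longlonglongrightarrow> K + M * norm (0::'a)"
    by (intro tendsto_intros e)
  thus ?thesis using main tendsto_lowerbound[of _ "K + M * norm (0::'a)" sequentially] by simp
qed

text \<open>For summable \<open>h\<close> the smoothing operators \<open>dprod h k \<circ> A ^^ k\<close> stay close to the identity. Up to
  sign, \<open>dprod h k\<close> is what the \<open>k\<close>-th power of the generator makes of them.\<close>

primrec dprod :: "(nat \<Rightarrow> real) \<Rightarrow> nat \<Rightarrow> 'a \<Rightarrow>\<^sub>L 'a" where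
  "dprod h 0 = id_blinfun"
| "dprod h (Suc k) = diffq (h k) o\<^sub>L dprod h k"

lemma diffq_A: "h > 0 \<Longrightarrow> diffq h (A x) = A (diffq h x)"
  by (simp add: diffq_apply T_A blinfun.bilinear_simps)

lemma dprod_A: "(\<And>j. h j > 0) \<Longrightarrow> dprod h k (A x) = A (dprod h k x)"
  by (induction k) (auto simp: diffq_A)

lemma dprod_norm:
  assumes "\<And>j. h j > 0" shows "norm (dprod h k) \<le> (\<Prod>j<k. (1 + M) / h j)"
proof (induction k)
  case 0 show ?case by (simp add: norm_blinfun_id_le)
next
  case (Suc k)
  have "norm (dprod h (Suc k)) \<le> norm (diffq (h k)) * norm (dprod h k)"
    by (simp add: norm_blinfun_compose)
  also have "\<dots> \<le> (1 + M) / h k * (\<Prod>j<k. (1 + M) / h j)"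
    using Suc assms M_nonneg by (intro mult_mono diffq_norm) (auto simp: less_imp_le)
  finally show ?case by (simp add: mult.commute)
qed

text \<open>Averaging preserves any bound that holds along the whole orbit. The induction carries
  all times \<open>t\<close> at once, because the mean at time \<open>t\<close> looks ahead to
  \<open>t + h k\<close>; the constant thereby stays \<open>M\<close> instead of growing like a
  power of \<open>M\<close>.\<close>

lemma dprod_Apow_orbit:
  assumes h: "\<And>j. h j > 0" and t: "t \<ge> 0"
  shows "norm (T t (dprod h k ((blinfun_apply A ^^ k) z))) \<le> M * norm z"
  using t
proof (induction k arbitrary: t)
  case 0 thus ?case by (simp add: T_apply_norm)
next
  case (Suc k)
  have "norm (T t (diffq (h k) (A (dprod h k ((blinfun_apply A ^^ k) z)))) - 0) \<le> M * norm z"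
    using Suc h by (intro diffq_A_norm_le) auto
  thus ?case using h by (simp add: dprod_A)
qed

lemma Apow_commute: "(blinfun_apply A ^^ k) (A x) = A ((blinfun_apply A ^^ k) x)"
  by (simp add: funpow_swap1)

text \<open>On the range of \<open>A\<close> orbits are Lipschitz, so averaging over length
  \<open>h k\<close> moves the point by a multiple of \<open>h k\<close>. The multiple does not
  depend on \<open>k\<close>, because \<open>dprod_Apow_orbit\<close> bounds the orbit of the
  already smoothed \<open>q\<close>; the displacements add up.\<close>

lemma dprod_Apow_approx:
  assumes h: "\<And>j. h j > 0"
  shows "norm (dprod h k ((blinfun_apply A ^^ k) (A z)) - A z) \<le> M * norm z * (\<Sum>j<k. h j)"
proof (induction k)
  case 0 show ?case by simp
next
  case (Suc k)
  define q where "q = dprod h k ((blinfun_apply A ^^ k) z)"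
  have q: "norm (T r q) \<le> M * norm z" if "r \<ge> 0" for r
    unfolding q_def using dprod_Apow_orbit[OF h that] .
  have Aq: "A q = dprod h k ((blinfun_apply A ^^ k) (A z))" using h by (simp add: q_def dprod_A Apow_commute)
  \<comment> \<open>\<open>T r (A q) - A q\<close> is \<open>- r\<close> times
    \<open>diffq r (A q)\<close>, a mean of the bounded orbit of \<open>q\<close>. The form
    \<open>0 + h k\<close> matches \<open>diffq_A_norm_le\<close> at time 0.\<close>
  have step: "norm (T r (A q) - A q) \<le> M * norm z * h k" if r: "0 \<le> r" "r \<le> 0 + h k" for r
  proof (cases "r = 0")
    case False
    have "norm (T 0 (diffq r (A q)) - 0) \<le> M * norm z"
      by (rule diffq_A_norm_le) (use q False r in auto)
    hence "norm (A q - T r (A q)) / r \<le> M * norm z"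
      using r by (simp add: T_0 diffq_apply)
    hence "norm (A q - T r (A q)) \<le> M * norm z * r"
      using False r by (simp add: divide_le_eq)
    also have "\<dots> \<le> M * norm z * h k" using r M_nonneg by (intro mult_left_mono) auto
    finally show ?thesis by (simp add: norm_minus_commute)
  qed (use h[of k] M_nonneg in \<open>simp add: T_0\<close>)
  have "norm (T 0 (diffq (h k) (A (A q))) - A q) \<le> M * norm z * h k"
    by (rule diffq_A_norm_le[OF h _ step]) auto
  hence "norm (dprod h (Suc k) ((blinfun_apply A ^^ Suc k) (A z)) - A q) \<le> M * norm z * h k"
    using h by (simp add: T_0 Aq dprod_A Apow_commute)
  moreover have "norm (A q - A z) \<le> M * norm z * (\<Sum>j<k. h j)" using Suc by (simp add: Aq)
  ultimately show ?case using norm_triangle_le[of "dprod h (Suc k) ((blinfun_apply A ^^ Suc k) (A z)) - A q" "A q - A z"]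
    by (simp add: algebra_simps)
qed

section \<open>Uniqueness for the second-order equation\<close>

text \<open>Applying \<open>A ^^ Suc k\<close> and then \<open>Q\<close> to the Bessel expression of
  \<open>U\<close> gives the quantity bounded one step earlier, with \<open>A ^^ k\<close> at
  \<open>U\<close>. \<open>bessel_norm_le\<close> with exponent \<open>2 * k\<close> then gains
  \<open>y^2\<close> over \<open>(2 * k + 2) * (2 * k + 1 + a)\<close>. Keeping \<open>Q\<close>
  fixed during the induction lets it later be the \<open>dprod\<close> belonging to the final
  \<open>k\<close>.\<close>

lemma bessel_Apow_norm_le:
  assumes V1: "\<And>t. t > 0 \<Longrightarrow> (U has_vector_derivative U1 t) (at t)"
    and V2: "\<And>t. t > 0 \<Longrightarrow> (U1 has_vector_derivative U2 t) (at t)"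
    and eq: "\<And>t. t > 0 \<Longrightarrow> U t = A (U2 t + (a / t) *\<^sub>R U1 t)"
    and a: "a > -1"
    and lim: "(U \<longlongrightarrow> 0) (at_right 0)" "((\<lambda>t. (t powr a) *\<^sub>R U1 t) \<longlongrightarrow> 0) (at_right 0)"
    and bound: "\<And>t. 0 < t \<Longrightarrow> t \<le> b \<Longrightarrow> norm (Q (U t)) \<le> c"
    and y: "0 < y" "y \<le> b"
    and Q: "bounded_linear Q"
  shows "norm (Q ((blinfun_apply A ^^ k) (U y))) \<le> c / (\<Prod>p<k. (2 * real p + 2) * (2 * real p + 1 + a)) * y powr (2 * real k)"
  using y
proof (induction k arbitrary: y)
  case 0 thus ?case using bound by simp
next
  case (Suc k)
  have c: "c \<ge> 0" using bound[OF Suc.prems] norm_ge_zero order_trans by blast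
  define R where "R x = Q ((blinfun_apply A ^^ Suc k) x)" for x
  have R: "bounded_linear R"
    unfolding R_def using bounded_linear_compose[OF Q bounded_linear_blinfun_funpow] .
  interpret R: bounded_linear R by (rule R)
  define P where "P = (\<Prod>p<k. (2 * real p + 2) * (2 * real p + 1 + a))"
  have P: "P > 0" unfolding P_def using a by (intro prod_pos) (auto intro!: mult_pos_pos)
  have "norm (R (U y)) \<le> c / P / ((2 * real k + 2) * (2 * real k + 1 + a)) * y powr (2 * real k + 2)"
  proof (rule bessel_norm_le[where V = "\<lambda>t. R (U t)" and ?V1.0 = "\<lambda>t. R (U1 t)" and ?V2.0 = "\<lambda>t. R (U2 t)"])
    show "((\<lambda>t. R (U t)) has_vector_derivative R (U1 t)) (at t)" if "t > 0" for t
      using R.has_vector_derivative[OF V1[OF that]] .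
    show "((\<lambda>t. R (U1 t)) has_vector_derivative R (U2 t)) (at t)" if "t > 0" for t
      using R.has_vector_derivative[OF V2[OF that]] .
    show "((\<lambda>t. R (U t)) \<longlongrightarrow> 0) (at_right 0)" using R.tendsto[OF lim(1)] by (simp add: R.zero)
    show "((\<lambda>t. (t powr a) *\<^sub>R R (U1 t)) \<longlongrightarrow> 0) (at_right 0)"
      using R.tendsto[OF lim(2)] by (simp add: R.zero R.scaleR)
    show "norm (R (U2 t) + (a / t) *\<^sub>R R (U1 t)) \<le> c / P * t powr (2 * real k)" if t: "0 < t" "t \<le> b" for t
    proof -
      have "R (U2 t) + (a / t) *\<^sub>R R (U1 t) = R (U2 t + (a / t) *\<^sub>R U1 t)"
        by (simp only: R.add R.scaleR)
      also have "\<dots> = Q ((blinfun_apply A ^^ k) (U t))"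
        by (simp add: R_def funpow_swap1 eq[OF t(1)])
      finally have "R (U2 t) + (a / t) *\<^sub>R R (U1 t) = Q ((blinfun_apply A ^^ k) (U t))" .
      thus ?thesis using Suc.IH[OF t] by (simp add: P_def)
    qed
    show "0 \<le> c / P" using c P by simp
  qed (use a Suc.prems in auto)
  also have "c / P / ((2 * real k + 2) * (2 * real k + 1 + a)) = c / (\<Prod>p<Suc k. (2 * real p + 2) * (2 * real p + 1 + a))"
    by (simp add: P_def)
  also have "2 * real k + 2 = 2 * real (Suc k)" by simp
  finally show ?case unfolding R_def .
qed

lemma bessel_unique:
  assumes V1: "\<And>t. t > 0 \<Longrightarrow> (U has_vector_derivative U1 t) (at t)"
    and V2: "\<And>t. t > 0 \<Longrightarrow> (U1 has_vector_derivative U2 t) (at t)"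
    and eq: "\<And>t. t > 0 \<Longrightarrow> U t = A (U2 t + (a / t) *\<^sub>R U1 t)"
    and a: "a > -1"
    and lim: "(U \<longlongrightarrow> 0) (at_right 0)" "((\<lambda>t. (t powr a) *\<^sub>R U1 t) \<longlongrightarrow> 0) (at_right 0)"
    and y: "0 < y"
  shows "U y = 0"
proof -
  \<comment> \<open>Near 0 the bound comes from the limit, on the rest of the interval from
    compactness.\<close>
  obtain C where C: "\<And>t. 0 < t \<Longrightarrow> t \<le> y \<Longrightarrow> norm (U t) \<le> C"
  proof -
    have "\<forall>\<^sub>F t in at_right 0. norm (U t) < 1"
      using order_tendstoD(2)[OF tendsto_norm_zero[OF lim(1)], of 1] by simp
    then obtain b where b: "b > 0" "\<And>t. 0 < t \<Longrightarrow> t < b \<Longrightarrow> norm (U t) < 1"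
      by (auto simp: eventually_at_right_field)
    have "continuous_on {b..y} U"
      using b(1)
      by (intro continuous_on_vector_derivative[where f' = U1] has_vector_derivative_at_within[OF V1]) auto
    hence "bounded (U ` {b..y})" by (intro compact_imp_bounded compact_continuous_image) auto
    then obtain B where B: "\<And>t. b \<le> t \<Longrightarrow> t \<le> y \<Longrightarrow> norm (U t) \<le> B"
      by (force simp: bounded_iff)
    show ?thesis
    proof (rule that[of "max 1 B"])
      fix t assume "0 < t" "t \<le> y"
      thus "norm (U t) \<le> max 1 B" using b(2)[of t] B[of t] by (cases "t < b") (auto simp: max_def)
    qed
  qed
  have C0: "C \<ge> 0" using C[OF y order_refl] norm_ge_zero order_trans by blast
  \<comment> \<open>Exhibits \<open>U y\<close> in the range of \<open>A\<close>, where
    \<open>dprod_Apow_approx\<close> controls the averages.\<close>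
  define z where "z = U2 y + (a / y) *\<^sub>R U1 y"
  have z: "U y = A z" using eq[OF y] by (simp add: z_def)
  \<comment> \<open>any exponent strictly between -2 and -1 makes \<open>h\<close> summable and keeps
    \<open>\<Prod>j<k. 1 / h j\<close> below \<open>(k!)\<^sup>2\<close>\<close>
  define h where "h j = (real j + 1) powr (-3/2)" for j
  have h: "h j > 0" for j by (simp add: h_def)
  have sh: "summable h"
  proof -
    have "summable (\<lambda>j. real (Suc j) powr (-3/2))"
      by (subst summable_Suc_iff) (simp add: summable_real_powr_iff)
    thus ?thesis by (simp add: h_def[abs_def] add.commute)
  qed
  \<comment> \<open>Lengths are taken from index \<open>J\<close> on. With \<open>J\<close> fixed,
    the number \<open>k\<close> of averages tends to infinity, which removes the Bessel term and
    leaves the displacement.\<close>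
  have le: "norm (U y) \<le> M * norm z * (\<Sum>j. h (j + J))" for J
  proof -
    define g where "g j = h (j + J)" for j
    have g: "g j > 0" for j by (simp add: g_def h)
    have sg: "summable g" unfolding g_def using sh by (simp add: summable_iff_shift)
    \<comment> \<open>The ratio of consecutive Bessel terms: the cost of one more difference
      quotient, the gain from two integrations, and \<open>y^2\<close>. It decays like
      \<open>p powr (-1/2)\<close>.\<close>
    define r where "r p = (1 + M) / g p / ((2 * real p + 2) * (2 * real p + 1 + a)) * y^2" for p
    have "(\<lambda>p. ((real p + real J + 1) powr (3/2)) / ((2 * real p + 2) * (2 * real p + 1 + a))) \<longlonglongrightarrow> 0"
      by real_asymp
    hence "(\<lambda>p. (1 + M) * y^2 * (((real p + real J + 1) powr (3/2)) / ((2 * real p + 2) * (2 * real p + 1 + a)))) \<longlonglongrightarrow> (1 + M) * y^2 * 0"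
      by (intro tendsto_mult tendsto_const)
    moreover have "(1 + M) * y^2 * (((real p + real J + 1) powr (3/2)) / ((2 * real p + 2) * (2 * real p + 1 + a))) = r p" for p
      by (simp add: r_def g_def h_def powr_minus field_simps)
    ultimately have "r \<longlonglongrightarrow> 0" by simp
    hence r: "(\<lambda>k. C * (\<Prod>p<k. r p)) \<longlonglongrightarrow> 0"
      using tendsto_mult_right_zero prod_tendsto_zero by blast
    have main: "norm (U y) \<le> C * (\<Prod>p<k. r p) + M * norm z * (\<Sum>j. g j)" for k
    proof -
      define N where "N = (\<Prod>j<k. (1 + M) / g j)"
      have N: "norm (dprod g k) \<le> N" unfolding N_def by (rule dprod_norm[OF g])
      have "norm (dprod g k ((blinfun_apply A ^^ k) (U y))) \<le> (N * C) / (\<Prod>p<k. (2 * real p + 2) * (2 * real p + 1 + a)) * y powr (2 * real k)"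
      proof (rule bessel_Apow_norm_le[OF V1 V2 eq a lim _ y order_refl blinfun.bounded_linear_right])
        fix t assume t: "0 < t" "t \<le> y"
        have "norm (dprod g k (U t)) \<le> norm (dprod g k) * norm (U t)" by (rule norm_blinfun)
        also have "\<dots> \<le> N * C" using N C[OF t] order_trans[OF norm_ge_zero N] by (intro mult_mono) auto
        finally show "norm (dprod g k (U t)) \<le> N * C" .
      qed
      also have "\<dots> = C * (\<Prod>p<k. r p)"
        using y powr_realpow[of y "2 * k"]
        by (simp add: r_def N_def prod_dividef prod.distrib power_mult power_mult_distrib)
      finally have 1: "norm (dprod g k ((blinfun_apply A ^^ k) (U y))) \<le> C * (\<Prod>p<k. r p)" .
      have "norm (dprod g k ((blinfun_apply A ^^ k) (U y)) - U y) \<le> M * norm z * (\<Sum>j<k. g j)"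
        unfolding z by (rule dprod_Apow_approx[OF g])
      also have "\<dots> \<le> M * norm z * (\<Sum>j. g j)"
        using M_nonneg g by (intro mult_left_mono sum_le_suminf sg) (auto simp: less_imp_le)
      finally show ?thesis using 1 norm_triangle_sub[of "U y" "dprod g k ((blinfun_apply A ^^ k) (U y))"]
        by (simp add: norm_minus_commute)
    qed
    have "(\<lambda>k. C * (\<Prod>p<k. r p) + M * norm z * (\<Sum>j. g j)) \<longlonglongrightarrow> 0 + M * norm z * (\<Sum>j. g j)"
      by (intro tendsto_intros r)
    from tendsto_lowerbound[OF this] main show ?thesis by (simp add: g_def)
  qed
  have "(\<lambda>J. M * norm z * (\<Sum>j. h (j + J))) \<longlonglongrightarrow> M * norm z * 0"
    by (intro tendsto_intros suminf_exist_split2 sh)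
  hence "norm (U y) \<le> M * norm z * 0" by (rule tendsto_lowerbound) (simp_all add: le)
  thus ?thesis by simp
qed

text \<open>If \<open>A x\<close> vanishes, so do its difference quotients, whose limit is
  \<open>- x\<close>.\<close>

lemma A_eq_0_iff: "A x = 0 \<longleftrightarrow> x = 0"
proof
  assume "A x = 0"
  hence "((\<lambda>t::real. 0) \<longlongrightarrow> - x) (at_right 0)" using A_generator[of x] by simp
  hence "- x = 0" by (intro tendsto_unique[OF _ _ tendsto_const]) auto
  thus "x = 0" by simp
qed simp

text \<open>The hypothesis \<open>eq\<close> is the equation of order two in the variable \<open>y\<^sup>2 / 4\<close>, whose
  derivative is \<open>(2 / y) \<partial>\<^sub>y\<close>. Differentiating it \<open>n\<close> times raises \<open>\<beta>\<close> by \<open>n\<close>; the missing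
  second derivative of \<open>Z n\<close> is recovered for \<open>A \<circ> Z n\<close> from the equation for \<open>Z (n - 1)\<close>.\<close>

lemma chain_unique:
  fixes Z :: "nat \<Rightarrow> real \<Rightarrow> 'a"
  assumes Z: "\<And>m y. m \<le> n \<Longrightarrow> y > 0 \<Longrightarrow> (Z m has_vector_derivative (y / 2) *\<^sub>R Z (Suc m) y) (at y)"
    and eq: "\<And>y. y > 0 \<Longrightarrow> Z 0 y = A (\<beta> *\<^sub>R Z 1 y + (y\<^sup>2 / 4) *\<^sub>R Z 2 y)"
    and n: "n > 0" and a: "2 * (\<beta> + n) - 1 > -1"
    and lim: "(Z n \<longlongrightarrow> 0) (at_right 0)"
      "((\<lambda>y. (y powr (2 * (\<beta> + n) - 1)) *\<^sub>R ((y / 2) *\<^sub>R Z (Suc n) y)) \<longlongrightarrow> 0) (at_right 0)"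
    and y: "y > 0"
  shows "Z n y = 0"
proof -
  have A_deriv: "((\<lambda>y. A (F y)) has_vector_derivative A D) (at y)"
    if "(F has_vector_derivative D) (at y)" for F D y
    using bounded_linear.has_vector_derivative[OF blinfun.bounded_linear_right that] .
  \<comment> \<open>Differentiating the equation for \<open>m\<close> gives the factor
    \<open>y / 2\<close> on both sides, which cancels; the derivative of \<open>y^2 / 4\<close>
    raises the first coefficient by 1.\<close>
  have eqs: "Z m y = A ((\<beta> + m) *\<^sub>R Z (Suc m) y + (y\<^sup>2 / 4) *\<^sub>R Z (Suc (Suc m)) y)"
    if "Suc m \<le> n" "y > 0" for m y
    using that
  proof (induction m arbitrary: y)
    case 0 thus ?case using eq by (simp add: numeral_2_eq_2)
  next
    case (Suc m)
    let ?E = "\<lambda>y. (\<beta> + m) *\<^sub>R Z (Suc m) y + (y\<^sup>2 / 4) *\<^sub>R Z (Suc (Suc m)) y"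
    have "(?E has_vector_derivative (\<beta> + m) *\<^sub>R ((y / 2) *\<^sub>R Z (Suc (Suc m)) y)
        + ((y\<^sup>2 / 4) *\<^sub>R ((y / 2) *\<^sub>R Z (Suc (Suc (Suc m))) y) + (2 * y / 4) *\<^sub>R Z (Suc (Suc m)) y)) (at y)"
      using Suc.prems by (auto intro!: derivative_eq_intros Z)
    also have "(\<beta> + m) *\<^sub>R ((y / 2) *\<^sub>R Z (Suc (Suc m)) y)
        + ((y\<^sup>2 / 4) *\<^sub>R ((y / 2) *\<^sub>R Z (Suc (Suc (Suc m))) y) + (2 * y / 4) *\<^sub>R Z (Suc (Suc m)) y)
      = (y / 2) *\<^sub>R ((\<beta> + Suc m) *\<^sub>R Z (Suc (Suc m)) y + (y\<^sup>2 / 4) *\<^sub>R Z (Suc (Suc (Suc m))) y)"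
      by (simp add: scaleR_right_distrib scaleR_left_distrib algebra_simps add_divide_distrib)
    finally have "(?E has_vector_derivative
        (y / 2) *\<^sub>R ((\<beta> + Suc m) *\<^sub>R Z (Suc (Suc m)) y + (y\<^sup>2 / 4) *\<^sub>R Z (Suc (Suc (Suc m))) y)) (at y)" .
    from A_deriv[OF this] have "((\<lambda>y. A (?E y)) has_vector_derivative
        (y / 2) *\<^sub>R A ((\<beta> + Suc m) *\<^sub>R Z (Suc (Suc m)) y + (y\<^sup>2 / 4) *\<^sub>R Z (Suc (Suc (Suc m))) y)) (at y)"
      by (simp only: blinfun.scaleR_right)
    hence "(Z m has_vector_derivative
        (y / 2) *\<^sub>R A ((\<beta> + Suc m) *\<^sub>R Z (Suc (Suc m)) y + (y\<^sup>2 / 4) *\<^sub>R Z (Suc (Suc (Suc m))) y)) (at y)"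
      by (rule has_vector_derivative_transform_within_open[of _ _ _ "{0<..}"])
        (use Suc in auto)
    from vector_derivative_unique_at[OF Z this] Suc.prems show ?case by simp
  qed
  obtain k where k: "n = Suc k" using n by (cases n) auto
  define Y where "Y = (\<lambda>y. A (Z n y))"
  define Y1 where "Y1 = (\<lambda>y. A (Z (Suc n) y))"
  have Y: "(Y has_vector_derivative (y / 2) *\<^sub>R Y1 y) (at y)" if "y > 0" for y
    using A_deriv[OF Z[OF order_refl that]] by (simp add: Y_def Y1_def blinfun.scaleR_right)
  have Y1_eq: "Y1 y = (4 / y\<^sup>2) *\<^sub>R (Z k y - (\<beta> + k) *\<^sub>R Y y)" if "y > 0" for y
    using eqs[of k y] that by (simp add: Y_def Y1_def k blinfun.bilinear_simps)
  have Y1: "(Y1 has_vector_derivative (2 / y) *\<^sub>R (Z n y - (\<beta> + n) *\<^sub>R Y1 y)) (at y)" if y: "y > 0" for y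
  proof -
    have "((\<lambda>y. (4 / y\<^sup>2) *\<^sub>R (Z k y - (\<beta> + k) *\<^sub>R Y y)) has_vector_derivative
      (4 / y\<^sup>2) *\<^sub>R ((y / 2) *\<^sub>R Z n y - (\<beta> + k) *\<^sub>R ((y / 2) *\<^sub>R Y1 y))
        + (- (8 / y ^ 3)) *\<^sub>R (Z k y - (\<beta> + k) *\<^sub>R Y y)) (at y)"
      using y Z[of k y] by (auto intro!: derivative_eq_intros Y simp: k divide_simps power_numeral_reduce)
    also have "(- (8 / y ^ 3)) *\<^sub>R (Z k y - (\<beta> + k) *\<^sub>R Y y) = (- (2 / y)) *\<^sub>R Y1 y"
      using y by (simp add: Y1_eq power_numeral_reduce)
    also have "(4 / y\<^sup>2) *\<^sub>R ((y / 2) *\<^sub>R Z n y - (\<beta> + k) *\<^sub>R ((y / 2) *\<^sub>R Y1 y)) + (- (2 / y)) *\<^sub>R Y1 y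
       = (2 / y) *\<^sub>R (Z n y - (\<beta> + n) *\<^sub>R Y1 y)"
      using y by (simp add: k power2_eq_square scaleR_right_distrib scaleR_right_diff_distrib scaleR_left_distrib add_divide_distrib distrib_left)
    finally show ?thesis
      by (rule has_vector_derivative_transform_within_open[of _ _ _ "{0<..}"]) (use y Y1_eq in auto)
  qed
  have "Y y = 0"
  proof (rule bessel_unique[OF Y _ _ a _ _ y])
    fix y :: real assume y: "y > 0"
    show "((\<lambda>y. (y / 2) *\<^sub>R Y1 y) has_vector_derivative
        (y / 2) *\<^sub>R ((2 / y) *\<^sub>R (Z n y - (\<beta> + n) *\<^sub>R Y1 y)) + (1 / 2) *\<^sub>R Y1 y) (at y)"
      by (rule has_vector_derivative_scaleR[OF _ Y1[OF y]]) (auto intro!: derivative_eq_intros)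
    \<comment> \<open>In the Bessel expression of \<open>Y\<close> the terms with \<open>Y1\<close>
      cancel for exactly this exponent, leaving \<open>Z n y\<close>, which \<open>A\<close> maps to
      \<open>Y y\<close>.\<close>
    have "(y / 2) *\<^sub>R ((2 / y) *\<^sub>R (Z n y - (\<beta> + n) *\<^sub>R Y1 y)) + (1 / 2) *\<^sub>R Y1 y
        + ((2 * (\<beta> + n) - 1) / y) *\<^sub>R ((y / 2) *\<^sub>R Y1 y)
        = Z n y - (\<beta> + n) *\<^sub>R Y1 y + (1 / 2 + (2 * (\<beta> + n) - 1) / 2) *\<^sub>R Y1 y"
      using y by (simp add: scaleR_left_distrib)
    also have "1 / 2 + (2 * (\<beta> + n) - 1) / 2 = \<beta> + n" by (simp add: diff_divide_distrib)
    also have "Z n y - (\<beta> + n) *\<^sub>R Y1 y + (\<beta> + n) *\<^sub>R Y1 y = Z n y" by simp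
    finally have "(y / 2) *\<^sub>R ((2 / y) *\<^sub>R (Z n y - (\<beta> + n) *\<^sub>R Y1 y)) + (1 / 2) *\<^sub>R Y1 y
        + ((2 * (\<beta> + n) - 1) / y) *\<^sub>R ((y / 2) *\<^sub>R Y1 y) = Z n y" .
    thus "Y y = A ((y / 2) *\<^sub>R ((2 / y) *\<^sub>R (Z n y - (\<beta> + n) *\<^sub>R Y1 y)) + (1 / 2) *\<^sub>R Y1 y
        + ((2 * (\<beta> + n) - 1) / y) *\<^sub>R ((y / 2) *\<^sub>R Y1 y))"
      by (simp only: Y_def)
  next
    show "(Y \<longlongrightarrow> 0) (at_right 0)"
      unfolding Y_def by (rule blinfun.tendsto_right_zero[OF lim(1)])
    have "((\<lambda>y. A ((y powr (2 * (\<beta> + n) - 1)) *\<^sub>R ((y / 2) *\<^sub>R Z (Suc n) y))) \<longlongrightarrow> 0) (at_right 0)"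
      by (rule blinfun.tendsto_right_zero[OF lim(2)])
    thus "((\<lambda>y. (y powr (2 * (\<beta> + n) - 1)) *\<^sub>R ((y / 2) *\<^sub>R Y1 y)) \<longlongrightarrow> 0) (at_right 0)"
      by (simp add: blinfun.scaleR_right Y1_def)
  qed
  thus ?thesis by (simp add: Y_def A_eq_0_iff)
qed

end

section \<open>Iterated differentiability on the open half-line\<close>

text \<open>The derivative is a witness, free for \<open>y\<close> \<le> 0, so closure properties
  follow by naming a formula; \<open>pos_differentiable_Suc_iff\<close> returns to
  \<open>dy\<close>.\<close>

primrec pos_differentiable :: "nat \<Rightarrow> (real \<Rightarrow> 'a::real_normed_vector) \<Rightarrow> bool" where
  "pos_differentiable 0 F \<longleftrightarrow> True"
| "pos_differentiable (Suc n) F \<longleftrightarrow>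
     (\<exists>G. (\<forall>y>0. (F has_vector_derivative G y) (at y)) \<and> pos_differentiable n G)"

declare pos_differentiable.simps(2) [simp del]

lemma pos_differentiable_SucI:
  "(\<And>y. y > 0 \<Longrightarrow> (F has_vector_derivative G y) (at y)) \<Longrightarrow> pos_differentiable n G \<Longrightarrow>
    pos_differentiable (Suc n) F"
  by (auto simp: pos_differentiable.simps(2))

lemma has_vector_derivative_cong_pos:
  assumes "\<And>y. y > 0 \<Longrightarrow> F y = G y" "y > 0" "(F has_vector_derivative D) (at y)"
  shows "(G has_vector_derivative D) (at y)"
  using has_vector_derivative_transform_within_open[OF assms(3), of "{0<..}" G] assms by auto

lemma pos_differentiable_cong:
  assumes "pos_differentiable n F" "\<And>y. y > 0 \<Longrightarrow> F y = G y"
  shows "pos_differentiable n G"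
  using assms
  by (cases n) (auto simp: pos_differentiable.simps(2) intro: has_vector_derivative_cong_pos)

lemma dy_eqI: "(F has_vector_derivative D) (at y) \<Longrightarrow> dy F y = D"
  by (simp add: dy_def vector_derivative_at)

lemma pos_differentiable_Suc_iff:
  "pos_differentiable (Suc n) F \<longleftrightarrow>
     (\<forall>y>0. (F has_vector_derivative dy F y) (at y)) \<and> pos_differentiable n (dy F)"
proof
  assume "pos_differentiable (Suc n) F"
  then obtain G where G: "\<And>y. y > 0 \<Longrightarrow> (F has_vector_derivative G y) (at y)" "pos_differentiable n G"
    by (auto simp: pos_differentiable.simps(2))
  have eq: "G y = dy F y" if "y > 0" for y using dy_eqI[OF G(1)[OF that]] by simp
  show "(\<forall>y>0. (F has_vector_derivative dy F y) (at y)) \<and> pos_differentiable n (dy F)"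
    using G(1) eq pos_differentiable_cong[OF G(2) eq] by auto
qed (auto intro: pos_differentiable_SucI)

lemma pos_differentiable_SucD: "pos_differentiable (Suc n) F \<Longrightarrow> pos_differentiable n F"
proof (induction n arbitrary: F)
  case (Suc n)
  then obtain G where "\<And>y. y > 0 \<Longrightarrow> (F has_vector_derivative G y) (at y)" "pos_differentiable (Suc n) G"
    by (auto simp only: pos_differentiable.simps(2)[of "Suc n" F])
  thus ?case by (intro pos_differentiable_SucI[of F G] Suc.IH)
qed simp

lemma pos_differentiable_add:
  "pos_differentiable n F \<Longrightarrow> pos_differentiable n G \<Longrightarrow> pos_differentiable n (\<lambda>y. F y + G y)"
proof (induction n arbitrary: F G)
  case (Suc n)
  then obtain F' G' where "\<And>y. y > 0 \<Longrightarrow> (F has_vector_derivative F' y) (at y)"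
      "\<And>y. y > 0 \<Longrightarrow> (G has_vector_derivative G' y) (at y)"
      "pos_differentiable n F'" "pos_differentiable n G'"
    by (auto simp: pos_differentiable.simps(2))
  thus ?case
    by (intro pos_differentiable_SucI[of _ "\<lambda>y. F' y + G' y"] has_vector_derivative_add Suc.IH)
qed simp

text \<open>The derivative of \<open>c / y\<close> is \<open>-1 / y\<close> times
  \<open>c / y\<close>, so the product rule yields terms of the same shape, covered by the induction
  hypothesis with varying \<open>c\<close>.\<close>

lemma pos_differentiable_divide:
  "pos_differentiable n F \<Longrightarrow> pos_differentiable n (\<lambda>y. (c / y) *\<^sub>R F y)"
proof (induction n arbitrary: F c)
  case (Suc n)
  from Suc.prems obtain G
    where G: "\<And>y. y > 0 \<Longrightarrow> (F has_vector_derivative G y) (at y)" "pos_differentiable n G"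
    by (auto simp: pos_differentiable.simps(2))
  let ?H = "\<lambda>y. (c / y) *\<^sub>R G y + (-1 / y) *\<^sub>R ((c / y) *\<^sub>R F y)"
  have "((\<lambda>y. (c / y) *\<^sub>R F y) has_vector_derivative ?H y) (at y)" if "y > 0" for y
    using that by (auto intro!: derivative_eq_intros G(1) simp: power2_eq_square)
  moreover have "pos_differentiable n ?H"
    by (intro pos_differentiable_add Suc.IH G pos_differentiable_SucD[OF Suc.prems])
  ultimately show ?case by (rule pos_differentiable_SucI)
qed simp

lemma pos_differentiable_two_over_y_dy:
  "pos_differentiable (m + n) F \<Longrightarrow> pos_differentiable n ((two_over_y_dy ^^ m) F)"
proof (induction m arbitrary: n)
  case (Suc m)
  hence "pos_differentiable (Suc n) ((two_over_y_dy ^^ m) F)" using Suc.IH[of "Suc n"] by simp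
  hence "pos_differentiable n (dy ((two_over_y_dy ^^ m) F))" by (simp only: pos_differentiable_Suc_iff)
  thus ?case
    using pos_differentiable_divide by (simp add: two_over_y_dy_def[of "(two_over_y_dy ^^ m) F"])
qed simp

lemma pos_differentiable_chain:
  assumes "\<And>j y. j < n \<Longrightarrow> y > 0 \<Longrightarrow> (V j has_vector_derivative V (Suc j) y) (at y)"
  shows "pos_differentiable n (V 0)"
  using assms
proof (induction n arbitrary: V)
  case (Suc n)
  have "pos_differentiable n (V (Suc 0))" by (rule Suc.IH) (use Suc.prems in auto)
  thus ?case using Suc.prems[of 0] by (intro pos_differentiable_SucI) auto
qed simp

lemma has_vector_derivative_if_tendsto:
  fixes F :: "real \<Rightarrow> 'a::real_normed_vector"
  assumes "((\<lambda>z. norm ((F z - F y) /\<^sub>R (z - y) - d)) \<longlongrightarrow> 0) (at y)"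
  shows "(F has_vector_derivative d) (at y)"
  unfolding has_vector_derivative_def has_derivative_iff_norm
proof
  have "norm (F z - F y - (z - y) *\<^sub>R d) / norm (z - y) = norm ((F z - F y) /\<^sub>R (z - y) - d)"
    if "z \<noteq> y" for z
  proof -
    have "F z - F y - (z - y) *\<^sub>R d = (z - y) *\<^sub>R ((F z - F y) /\<^sub>R (z - y) - d)"
      using that by (simp add: scaleR_right_diff_distrib)
    thus ?thesis using that by simp
  qed
  thus "((\<lambda>z. norm (F z - F y - (z - y) *\<^sub>R d) / norm (z - y)) \<longlongrightarrow> 0) (at y)"
    by (intro Lim_transform_eventually[OF assms]) (auto simp: eventually_at_filter)
qed (rule bounded_linear_scaleR_left)

section \<open>Domains of powers as ranges of powers of the bounded inverse\<close>

locale boundedly_invertible =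
  fixes D :: "'a::banach set" and L :: "'a \<Rightarrow> 'a" and B :: "'a \<Rightarrow>\<^sub>L 'a"
  assumes B_in: "B x \<in> D" and L_B: "L (B x) = x" and B_L: "x \<in> D \<Longrightarrow> B (L x) = x"
begin

lemma Lpow_Bpow: "(L ^^ k) ((blinfun_apply B ^^ k) x) = x"
proof (induction k)
  case (Suc k)
  have "(L ^^ Suc k) ((blinfun_apply B ^^ Suc k) x) = (L ^^ k) (L (B ((blinfun_apply B ^^ k) x)))"
    by (simp add: funpow_swap1)
  thus ?case using Suc by (simp add: L_B)
qed simp

lemma Bpow_Lpow: "x \<in> dom_pow D L k \<Longrightarrow> (blinfun_apply B ^^ k) ((L ^^ k) x) = x"
proof (induction k arbitrary: x)
  case (Suc k)
  have "(blinfun_apply B ^^ Suc k) ((L ^^ Suc k) x) = B ((blinfun_apply B ^^ k) ((L ^^ k) (L x)))"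
    by (simp add: funpow_swap1)
  thus ?case using Suc by (simp add: B_L)
qed simp

text \<open>As \<open>L ^^ k\<close> maps its domain onto the whole space with inverse
  \<open>B ^^ k\<close>, differentiability in the graph norm becomes differentiability of
  \<open>F\<close> in the norm of the space.\<close>

definition regular :: "nat \<Rightarrow> (real \<Rightarrow> 'a) \<Rightarrow> bool" where
  "regular N U \<longleftrightarrow> (\<forall>k\<le>N. \<exists>F. pos_differentiable (2 * (N - k)) F \<and>
     (\<forall>y>0. U y = (blinfun_apply B ^^ k) (F y)))"

lemma C_into_dom_powD:
  assumes "C_into_dom_pow n D L k U"
  shows "\<exists>F. pos_differentiable n F \<and> (\<forall>y>0. U y = (blinfun_apply B ^^ k) (F y))"
proof -
  interpret Bk: bounded_linear "blinfun_apply B ^^ k" by (rule bounded_linear_blinfun_funpow)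
  from assms obtain V where "\<forall>y>0. V 0 y = U y" "\<forall>j\<le>n. \<forall>y>0. V j y \<in> dom_pow D L k"
      "\<forall>j<n. \<forall>y>0. ((\<lambda>z. graph_norm L k ((V j z - V j y) /\<^sub>R (z - y) - V (Suc j) y)) \<longlongrightarrow> 0) (at y)"
    unfolding C_into_dom_pow_def by (elim exE conjE) (rule that)
  hence V0: "\<And>y. y > 0 \<Longrightarrow> V 0 y = U y"
    and dom: "\<And>j y. j \<le> n \<Longrightarrow> y > 0 \<Longrightarrow> V j y \<in> dom_pow D L k"
    and lim: "\<And>j y. j < n \<Longrightarrow> y > 0 \<Longrightarrow>
      ((\<lambda>z. graph_norm L k ((V j z - V j y) /\<^sub>R (z - y) - V (Suc j) y)) \<longlongrightarrow> 0) (at y)"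
    by simp_all
  define F where "F j y = (L ^^ k) (V j y)" for j y
  have F: "V j y = (blinfun_apply B ^^ k) (F j y)" if "j \<le> n" "y > 0" for j y
    using Bpow_Lpow[OF dom[OF that]] by (simp add: F_def)
  have "(F j has_vector_derivative F (Suc j) y) (at y)" if j: "j < n" and y: "y > 0" for j y
  proof (rule has_vector_derivative_if_tendsto, rule tendsto_sandwich[OF _ _ tendsto_const lim[OF j y]])
    have "norm ((F j z - F j y) /\<^sub>R (z - y) - F (Suc j) y)
        \<le> graph_norm L k ((V j z - V j y) /\<^sub>R (z - y) - V (Suc j) y)" if "z > 0" for z
    proof -
      \<comment> \<open>\<open>L\<close> is not assumed linear. Linearity of \<open>B ^^ k\<close>
        collects the quotient under one application, which \<open>L ^^ k\<close> in the graph norm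
        cancels.\<close>
      have "(V j z - V j y) /\<^sub>R (z - y) - V (Suc j) y
          = (blinfun_apply B ^^ k) ((F j z - F j y) /\<^sub>R (z - y) - F (Suc j) y)"
        using j y that by (simp add: F Bk.diff Bk.scaleR)
      thus ?thesis by (simp add: graph_norm_def Lpow_Bpow)
    qed
    moreover have "\<forall>\<^sub>F z in at y. z > 0"
      using y by (intro order_tendstoD(1)[OF tendsto_ident_at])
    ultimately show "\<forall>\<^sub>F z in at y. norm ((F j z - F j y) /\<^sub>R (z - y) - F (Suc j) y)
        \<le> graph_norm L k ((V j z - V j y) /\<^sub>R (z - y) - V (Suc j) y)"
      by (auto elim: eventually_mono)
  qed simp
  hence "pos_differentiable n (F 0)" by (rule pos_differentiable_chain)
  thus ?thesis using F[of 0] V0 by auto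
qed

lemma regular_for_orderD: "regular_for_order N D L U \<Longrightarrow> regular N U"
  unfolding regular_for_order_def regular_def by (intro allI impI C_into_dom_powD) simp

lemma regular_pos_differentiable:
  assumes "regular N U" shows "pos_differentiable (2 * N) U"
proof -
  from assms obtain F where "pos_differentiable (2 * (N - 0)) F" "\<forall>y>0. U y = (blinfun_apply B ^^ 0) (F y)"
    unfolding regular_def by blast
  thus ?thesis using pos_differentiable_cong[of "2 * N" F U] by simp
qed

lemma regular_in_domain:
  assumes "regular (Suc N) U" "y > 0" shows "B (L (U y)) = U y"
proof -
  from assms(1) have "\<exists>F. \<forall>y>0. U y = (blinfun_apply B ^^ 1) (F y)"
    unfolding regular_def by (metis One_nat_def Suc_le_mono le0)
  thus ?thesis using assms(2) by (auto simp: L_B)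
qed

text \<open>Two representations of \<open>U\<close> are combined: the one with \<open>B ^^ k\<close>
  has the two extra derivatives consumed by \<open>dy\<close>, while the one with
  \<open>B ^^ Suc k\<close> has a factor \<open>B\<close> for \<open>L\<close> to cancel. Both leave
  \<open>2 * (N - k)\<close> derivatives.\<close>

lemma regular_ext_op:
  assumes "regular (Suc N) U" shows "regular N (ext_op L a U)"
  unfolding regular_def
proof (intro allI impI)
  fix k assume k: "k \<le> N"
  interpret Bk: bounded_linear "blinfun_apply B ^^ k" by (rule bounded_linear_blinfun_funpow)
  from assms k obtain F where F: "pos_differentiable (2 * (Suc N - k)) F"
      "\<And>y. y > 0 \<Longrightarrow> U y = (blinfun_apply B ^^ k) (F y)"
    unfolding regular_def by (meson le_SucI)
  from assms k obtain H where H: "pos_differentiable (2 * (N - k)) H"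
      "\<And>y. y > 0 \<Longrightarrow> U y = (blinfun_apply B ^^ Suc k) (H y)"
    unfolding regular_def by (metis Suc_le_mono diff_Suc_Suc)
  have "2 * (Suc N - k) = Suc (Suc (2 * (N - k)))" using k by simp
  hence "pos_differentiable (Suc (Suc (2 * (N - k)))) F" using F(1) by (simp only:)
  hence F': "\<forall>y>0. (F has_vector_derivative dy F y) (at y)"
      "\<forall>y>0. (dy F has_vector_derivative dy (dy F) y) (at y)"
      "pos_differentiable (Suc (2 * (N - k))) (dy F)" "pos_differentiable (2 * (N - k)) (dy (dy F))"
    unfolding pos_differentiable_Suc_iff by blast+
  have 1: "dy U y = (blinfun_apply B ^^ k) (dy F y)" if y: "y > 0" for y
    by (rule dy_eqI, rule has_vector_derivative_cong_pos[OF F(2)[symmetric] y])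
      (use Bk.has_vector_derivative F'(1) y in auto)
  have 2: "dy (dy U) y = (blinfun_apply B ^^ k) (dy (dy F) y)" if y: "y > 0" for y
    by (rule dy_eqI, rule has_vector_derivative_cong_pos[OF 1[symmetric] y])
      (use Bk.has_vector_derivative F'(2) y in auto)
  have 3: "L (U y) = (blinfun_apply B ^^ k) (H y)" if "y > 0" for y
    using H(2)[OF that] by (simp add: L_B)
  let ?G = "\<lambda>y. H y + (a / y) *\<^sub>R dy F y + dy (dy F) y"
  have "pos_differentiable (2 * (N - k)) ?G"
    by (intro pos_differentiable_add pos_differentiable_divide H(1) F'(4) pos_differentiable_SucD[OF F'(3)])
  moreover have "ext_op L a U y = (blinfun_apply B ^^ k) (?G y)" if "y > 0" for y
    using 1 2 3 that by (simp add: ext_op_def Bk.add Bk.scaleR)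
  ultimately show "\<exists>F. pos_differentiable (2 * (N - k)) F \<and>
      (\<forall>y>0. ext_op L a U y = (blinfun_apply B ^^ k) (F y))" by blast
qed

lemma regular_ext_op_pow: "regular (m + N) U \<Longrightarrow> regular N ((ext_op L a ^^ m) U)"
proof (induction m arbitrary: N)
  case (Suc m)
  have "regular (Suc N) ((ext_op L a ^^ m) U)" using Suc.IH[of "Suc N"] Suc.prems by simp
  thus ?case by (simp add: regular_ext_op)
qed simp

end

section \<open>The two initial value problems\<close>

locale extension_problem = bounded_semigroup T A M + boundedly_invertible D L "- A"
  for T :: "real \<Rightarrow> 'a::banach \<Rightarrow>\<^sub>L 'a" and A M and D :: "'a set" and L
begin

text \<open>Descending induction on \<open>m\<close>: once the iterates of order
  \<open>Suc m\<close> agree, the difference of those of order \<open>m\<close> solves the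
  homogeneous second-order equation with zero data. Subtraction takes place after applying
  \<open>A\<close>, whose linearity is at hand, unlike that of \<open>L\<close>.\<close>

lemma higher_order_unique:
  assumes reg: "regular (Suc n) U" "regular (Suc n) W"
    and eq: "\<And>y. y > 0 \<Longrightarrow> (ext_op L a ^^ Suc n) U y = 0" "\<And>y. y > 0 \<Longrightarrow> (ext_op L a ^^ Suc n) W y = 0"
    and lim0: "\<And>m. m \<le> n \<Longrightarrow> ((ext_op L a ^^ m) U \<longlongrightarrow> u m) (at_right 0)"
      "\<And>m. m \<le> n \<Longrightarrow> ((ext_op L a ^^ m) W \<longlongrightarrow> u m) (at_right 0)"
    and lim1: "\<And>m. m \<le> n \<Longrightarrow> ((\<lambda>y. (y powr a) *\<^sub>R dy ((ext_op L a ^^ m) U) y) \<longlongrightarrow> v m) (at_right 0)"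
      "\<And>m. m \<le> n \<Longrightarrow> ((\<lambda>y. (y powr a) *\<^sub>R dy ((ext_op L a ^^ m) W) y) \<longlongrightarrow> v m) (at_right 0)"
    and a: "a > -1" and y: "y > 0"
  shows "U y = W y"
proof -
  have "\<forall>y>0. (ext_op L a ^^ m) U y = (ext_op L a ^^ m) W y" if "m \<le> Suc n" for m
    using that
  proof (induction rule: inc_induct)
    case base show ?case using eq by simp
  next
    case (step m)
    hence m: "m \<le> n" by simp
    have props: "((ext_op L a ^^ m) X has_vector_derivative dy ((ext_op L a ^^ m) X) y) (at y)"
        "(dy ((ext_op L a ^^ m) X) has_vector_derivative dy (dy ((ext_op L a ^^ m) X)) y) (at y)"
        "(ext_op L a ^^ m) X y = A (dy (dy ((ext_op L a ^^ m) X)) y + (a / y) *\<^sub>R dy ((ext_op L a ^^ m) X) y)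
          - A ((ext_op L a ^^ Suc m) X y)"
      if X: "regular (Suc n) X" and y: "y > 0" for X y
    proof -
      have r: "regular (Suc (n - m)) ((ext_op L a ^^ m) X)"
        by (rule regular_ext_op_pow) (use X m in simp)
      have "pos_differentiable (Suc (Suc (2 * (n - m)))) ((ext_op L a ^^ m) X)"
        using regular_pos_differentiable[OF r] by simp
      thus "((ext_op L a ^^ m) X has_vector_derivative dy ((ext_op L a ^^ m) X) y) (at y)"
        "(dy ((ext_op L a ^^ m) X) has_vector_derivative dy (dy ((ext_op L a ^^ m) X)) y) (at y)"
        using y unfolding pos_differentiable_Suc_iff by blast+
      \<comment> \<open>Apply \<open>A\<close> to the definition of the next iterate; on the domain
        \<open>A\<close> after \<open>L\<close> is minus the identity.\<close>
      show "(ext_op L a ^^ m) X y = A (dy (dy ((ext_op L a ^^ m) X)) y + (a / y) *\<^sub>R dy ((ext_op L a ^^ m) X) y)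
          - A ((ext_op L a ^^ Suc m) X y)"
        using regular_in_domain[OF r y]
        by (simp add: ext_op_def[of L a "(ext_op L a ^^ m) X"] blinfun.bilinear_simps)
    qed
    show ?case
    proof (intro allI impI)
      fix y :: real assume y: "y > 0"
      let ?U = "(ext_op L a ^^ m) U" and ?W = "(ext_op L a ^^ m) W"
      have "?U y - ?W y = 0"
      proof (rule bessel_unique[where U = "\<lambda>y. ?U y - ?W y" and ?U1.0 = "\<lambda>y. dy ?U y - dy ?W y"
            and ?U2.0 = "\<lambda>y. dy (dy ?U) y - dy (dy ?W) y", OF _ _ _ a _ _ y])
        fix y :: real assume y: "y > 0"
        show "((\<lambda>y. ?U y - ?W y) has_vector_derivative dy ?U y - dy ?W y) (at y)"
          by (intro has_vector_derivative_diff props reg y)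
        show "((\<lambda>y. dy ?U y - dy ?W y) has_vector_derivative dy (dy ?U) y - dy (dy ?W) y) (at y)"
          by (intro has_vector_derivative_diff props reg y)
        have "(ext_op L a ^^ Suc m) U y = (ext_op L a ^^ Suc m) W y" using step.IH y by blast
        thus "?U y - ?W y = A (dy (dy ?U) y - dy (dy ?W) y + (a / y) *\<^sub>R (dy ?U y - dy ?W y))"
          using props(3)[OF reg(1) y] props(3)[OF reg(2) y]
          by (simp add: blinfun.bilinear_simps scaleR_diff_right del: funpow.simps)
      next
        show "((\<lambda>y. ?U y - ?W y) \<longlongrightarrow> 0) (at_right 0)"
          using tendsto_diff[OF lim0[OF m]] by simp
        show "((\<lambda>y. (y powr a) *\<^sub>R (dy ?U y - dy ?W y)) \<longlongrightarrow> 0) (at_right 0)"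
          using tendsto_diff[OF lim1[OF m]] by (simp add: scaleR_diff_right)
      qed
      thus "?U y = ?W y" by simp
    qed
  qed
  from this[of 0] y show ?thesis by simp
qed

text \<open>The difference \<open>Z n\<close> of the highest iterates vanishes by uniqueness for a
  second-order equation. The lower ones follow in descending order, each having derivative 0 and
  limit 0.\<close>

lemma second_order_unique:
  assumes reg: "\<And>X. X \<in> {U, W} \<Longrightarrow> pos_differentiable (Suc n) X"
      "\<And>X. X \<in> {U, W} \<Longrightarrow> pos_differentiable 2 X"
    and dom: "\<And>X y. X \<in> {U, W} \<Longrightarrow> y > 0 \<Longrightarrow> X y = - A (L (X y))"
    and eq: "\<And>X y. X \<in> {U, W} \<Longrightarrow> y > 0 \<Longrightarrow> ext_op L (1 - 2 * s) X y = 0"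
    and lim: "\<And>X m. X \<in> {U, W} \<Longrightarrow> m \<le> n \<Longrightarrow> ((two_over_y_dy ^^ m) X \<longlongrightarrow> u m) (at_right 0)"
      "\<And>X m. X \<in> {U, W} \<Longrightarrow> m \<le> n \<Longrightarrow>
        ((\<lambda>y. (y powr (1 - 2 * (s - real n))) *\<^sub>R dy ((two_over_y_dy ^^ m) X) y) \<longlongrightarrow> v m) (at_right 0)"
    and s: "s - n < 1" and y: "y > 0"
  shows "U y = W y"
proof -
  define E where "E X m = (two_over_y_dy ^^ m) X" for X :: "real \<Rightarrow> 'a" and m
  define Z where "Z m y = E U m y - E W m y" for m y
  have dyE: "dy (E X m) y = (y / 2) *\<^sub>R E X (Suc m) y" if "y > 0" for X m y
    using that by (simp add: E_def two_over_y_dy_def[of "(two_over_y_dy ^^ m) X"])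
  have E: "(E X m has_vector_derivative (y / 2) *\<^sub>R E X (Suc m) y) (at y)"
    if X: "X \<in> {U, W}" and m: "m \<le> n" and y: "y > 0" for X m y
  proof -
    have "pos_differentiable (Suc (n - m)) (E X m)"
      unfolding E_def by (rule pos_differentiable_two_over_y_dy) (use reg(1)[OF X] m in simp)
    thus ?thesis using y by (simp add: pos_differentiable_Suc_iff dyE)
  qed
  have Z: "(Z m has_vector_derivative (y / 2) *\<^sub>R Z (Suc m) y) (at y)" if "m \<le> n" "y > 0" for m y
    using has_vector_derivative_diff[OF E[of U, OF _ that] E[of W, OF _ that]]
    by (simp add: Z_def[abs_def] scaleR_diff_right)
  have limZ: "(Z m \<longlongrightarrow> 0) (at_right 0)" if "m \<le> n" for m
    using tendsto_diff[OF lim(1)[of U m] lim(1)[of W m]] that by (simp add: Z_def[abs_def] E_def)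
  let ?a = "1 - 2 * (s - real n)"
  have limZ1: "((\<lambda>y. (y powr ?a) *\<^sub>R ((y / 2) *\<^sub>R Z (Suc n) y)) \<longlongrightarrow> 0) (at_right 0)"
  proof -
    have "((\<lambda>y. (y powr ?a) *\<^sub>R dy (E U n) y - (y powr ?a) *\<^sub>R dy (E W n) y) \<longlongrightarrow> 0) (at_right 0)"
      using tendsto_diff[OF lim(2)[of U n] lim(2)[of W n]] by (simp add: E_def)
    moreover have "\<forall>\<^sub>F y in at_right 0. (y powr ?a) *\<^sub>R dy (E U n) y - (y powr ?a) *\<^sub>R dy (E W n) y
        = (y powr ?a) *\<^sub>R ((y / 2) *\<^sub>R Z (Suc n) y)"
      using eventually_at_right_less by eventually_elim (simp add: dyE Z_def scaleR_diff_right)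
    ultimately show ?thesis by (rule Lim_transform_eventually)
  qed
  have X2: "(X has_vector_derivative dy X y) (at y)" "(dy X has_vector_derivative dy (dy X) y) (at y)"
      "X y = A (dy (dy X) y + ((1 - 2 * s) / y) *\<^sub>R dy X y)"
    if X: "X \<in> {U, W}" and y: "y > 0" for X y
  proof -
    show "(X has_vector_derivative dy X y) (at y)" "(dy X has_vector_derivative dy (dy X) y) (at y)"
      using reg(2)[OF X] y unfolding numeral_2_eq_2 pos_differentiable_Suc_iff by blast+
    have "dy (dy X) y + ((1 - 2 * s) / y) *\<^sub>R dy X y = - L (X y)"
      using eq[OF X y] by (simp add: ext_op_def eq_neg_iff_add_eq_0 add_ac)
    thus "X y = A (dy (dy X) y + ((1 - 2 * s) / y) *\<^sub>R dy X y)"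
      using dom[OF X y] by (simp add: blinfun.minus_right)
  qed
  \<comment> \<open>For \<open>n = 0\<close> there is no preceding equation for
    \<open>chain_unique\<close> to use, but the second derivative is given and
    \<open>bessel_unique\<close> applies directly.\<close>
  have Zn: "Z n y = 0" if y: "y > 0" for y
  proof (cases "n = 0")
    case True
    have "U y - W y = 0"
    proof (rule bessel_unique[where U = "\<lambda>y. U y - W y" and ?U1.0 = "\<lambda>y. dy U y - dy W y"
          and ?U2.0 = "\<lambda>y. dy (dy U) y - dy (dy W) y" and a = "1 - 2 * s", OF _ _ _ _ _ _ y])
      fix y :: real assume y: "y > 0"
      show "((\<lambda>y. U y - W y) has_vector_derivative dy U y - dy W y) (at y)"
        by (intro has_vector_derivative_diff X2 y) auto
      show "((\<lambda>y. dy U y - dy W y) has_vector_derivative dy (dy U) y - dy (dy W) y) (at y)"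
        by (intro has_vector_derivative_diff X2 y) auto
      show "U y - W y = A (dy (dy U) y - dy (dy W) y + ((1 - 2 * s) / y) *\<^sub>R (dy U y - dy W y))"
        using X2(3)[of U y] X2(3)[of W y] y
        by (simp add: blinfun.bilinear_simps scaleR_diff_right)
    next
      show "((\<lambda>y. U y - W y) \<longlongrightarrow> 0) (at_right 0)"
        using limZ[of 0] by (simp add: Z_def[abs_def] E_def)
      show "((\<lambda>y. (y powr (1 - 2 * s)) *\<^sub>R (dy U y - dy W y)) \<longlongrightarrow> 0) (at_right 0)"
        using tendsto_diff[OF lim(2)[of U 0] lim(2)[of W 0]] True by (simp add: scaleR_diff_right)
    qed (use s True in simp)
    thus ?thesis using True by (simp add: Z_def E_def)
  next
    case False
    \<comment> \<open>To the coefficient of \<open>E X 1\<close> the second derivative contributes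
      \<open>1 / 2\<close> and the first-order term \<open>(1 - 2 * s) / 2\<close>, whence
      \<open>1 - s\<close>. Differentiability of \<open>E X 1\<close> comes from
      \<open>n > 0\<close>.\<close>
    have EX: "X y = A ((1 - s) *\<^sub>R E X 1 y + (y\<^sup>2 / 4) *\<^sub>R E X 2 y)"
      if X: "X \<in> {U, W}" and y: "y > 0" for X y
    proof -
      have d: "dy X y = (y / 2) *\<^sub>R E X 1 y" if "y > 0" for y
        using dyE[OF that, of X 0] by (simp add: E_def)
      have "((\<lambda>y. (y / 2) *\<^sub>R E X 1 y) has_vector_derivative
          (y / 2) *\<^sub>R ((y / 2) *\<^sub>R E X (Suc 1) y) + (1 / 2) *\<^sub>R E X 1 y) (at y)"
        by (rule has_vector_derivative_scaleR[OF _ E[OF X _ y]])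
          (use False in \<open>auto intro!: derivative_eq_intros\<close>)
      hence "(dy X has_vector_derivative
          (y / 2) *\<^sub>R ((y / 2) *\<^sub>R E X (Suc 1) y) + (1 / 2) *\<^sub>R E X 1 y) (at y)"
        by (rule has_vector_derivative_cong_pos[OF _ y, rotated]) (simp add: d)
      hence "dy (dy X) y = (y / 2) *\<^sub>R ((y / 2) *\<^sub>R E X (Suc 1) y) + (1 / 2) *\<^sub>R E X 1 y"
        by (rule dy_eqI)
      hence "dy (dy X) y + ((1 - 2 * s) / y) *\<^sub>R dy X y
          = (1 / 2 + (1 - 2 * s) / 2) *\<^sub>R E X 1 y + (y\<^sup>2 / 4) *\<^sub>R E X 2 y"
        using y by (simp add: d scaleR_left_distrib power2_eq_square numeral_2_eq_2)
      also have "1 / 2 + (1 - 2 * s) / 2 = 1 - s" by (simp add: field_simps)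
      finally show ?thesis using X2(3)[OF X y] by simp
    qed
    have a: "2 * (1 - s + real n) - 1 = ?a" by simp
    show ?thesis
    proof (rule chain_unique[where Z = Z and \<beta> = "1 - s", OF Z _ _ _ limZ _ y])
      fix y :: real assume y: "y > 0"
      show "Z 0 y = A ((1 - s) *\<^sub>R Z 1 y + (y\<^sup>2 / 4) *\<^sub>R Z 2 y)"
        using EX[of U y] EX[of W y] y
        by (simp add: Z_def E_def[of _ 0] blinfun.bilinear_simps scaleR_diff_right)
    next
      show "((\<lambda>y. (y powr (2 * (1 - s + real n) - 1)) *\<^sub>R ((y / 2) *\<^sub>R Z (Suc n) y)) \<longlongrightarrow> 0) (at_right 0)"
        by (rule limZ1[folded a])
    qed (use False s in simp_all)
  qed
  have "\<forall>y>0. Z m y = 0" if "m \<le> n" for m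
    using that
  proof (induction rule: inc_induct)
    case base show ?case using Zn by blast
  next
    case (step m)
    \<comment> \<open>The integration estimate with \<open>c = 0\<close> and
      \<open>q = 0\<close>.\<close>
    have "norm (Z m y) \<le> 0 / (0 + 1) * y powr (0 + 1)" if "y > 0" for y
    proof (rule norm_le_of_vector_derivative_powr[where f' = "\<lambda>_. 0" and b = y])
      show "(Z m has_vector_derivative 0) (at t)" if "t > 0" for t
        using Z[of m t] step that by simp
      show "(Z m \<longlongrightarrow> 0) (at_right 0)" using limZ step by simp
    qed (use that in auto)
    thus ?case by simp
  qed
  from this[of 0] y show ?thesis by (simp add: Z_def E_def)
qed

end

section \<open>From the generator to its bounded inverse, and the theorem\<close>

lemma extension_problem_generator:
  fixes T :: "real \<Rightarrow> 'a::banach \<Rightarrow>\<^sub>L 'a"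
  assumes C0: "C0_semigroup T" and bdd: "uniformly_bounded_semigroup T"
    and gen: "is_generator D L T" and res: "0 \<in> resolvent_set D L"
  obtains A M where "extension_problem T A M D L"
proof -
  \<comment> \<open>The resolvent at 0 inverts \<open>- L\<close>, hence the signs in
    \<open>L_A\<close> and \<open>A_L\<close>.\<close>
  define A0 where "A0 = inv_into D (\<lambda>x. 0 *\<^sub>R x - L x)"
  define A where "A = Blinfun A0"
  have bij: "bij_betw (\<lambda>x. 0 *\<^sub>R x - L x) D UNIV" and "bounded_linear A0"
    using res by (auto simp: resolvent_set_def A0_def)
  hence A: "blinfun_apply A = A0" by (simp add: A_def bounded_linear_Blinfun_apply)
  have A_in: "A x \<in> D" for x
    using bij unfolding A A0_def by (intro inv_into_into) (simp add: bij_betw_def)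
  have L_A: "L (A x) = - x" for x
    using bij_betw_inv_into_right[OF bij, of x] by (simp add: A A0_def minus_equation_iff)
  have A_L: "A (L x) = - x" if "x \<in> D" for x
  proof -
    have "A (- L x) = x" using bij_betw_inv_into_left[OF bij that] by (simp add: A A0_def)
    thus ?thesis by (simp add: blinfun.minus_right minus_equation_iff)
  qed
  have lim: "((\<lambda>t. (T t x - x) /\<^sub>R t) \<longlongrightarrow> L x) (at_right 0)" if "x \<in> D" for x
    using gen that by (auto simp: is_generator_def)
  have add: "T (r + t) = T r o\<^sub>L T t" if "r \<ge> 0" "t \<ge> 0" for r t
    using C0 that by (simp add: C0_semigroup_def)
  obtain M where M: "\<And>t. t \<ge> 0 \<Longrightarrow> norm (T t) \<le> M"
    using bdd by (auto simp: uniformly_bounded_semigroup_def)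
  \<comment> \<open>\<open>T t\<close> commutes with the difference quotients, so it keeps
    \<open>A x\<close> in the domain and commutes with \<open>L\<close> there; applying
    \<open>A\<close> gives the claim.\<close>
  have TA: "T t (A x) = A (T t x)" if t: "t \<ge> 0" for t x
  proof -
    have *: "((\<lambda>h. T t ((T h (A x) - A x) /\<^sub>R h)) \<longlongrightarrow> T t (L (A x))) (at_right 0)"
      by (intro blinfun.tendsto tendsto_const lim A_in)
    have "\<forall>\<^sub>F h in at_right 0. T t ((T h (A x) - A x) /\<^sub>R h) = (T h (T t (A x)) - T t (A x)) /\<^sub>R h"
      using eventually_at_right_less
    proof eventually_elim
      case (elim h)
      have "T t o\<^sub>L T h = T h o\<^sub>L T t" using add[of t h] add[of h t] t elim by (simp add: add.commute)
      from arg_cong[OF this, of "\<lambda>F. blinfun_apply F (A x)"]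
      have "T t (T h (A x)) = T h (T t (A x))" by simp
      thus ?case by (simp add: blinfun.bilinear_simps)
    qed
    with * have lim': "((\<lambda>h. (T h (T t (A x)) - T t (A x)) /\<^sub>R h) \<longlongrightarrow> T t (L (A x))) (at_right 0)"
      by (rule Lim_transform_eventually)
    hence D: "T t (A x) \<in> D" using gen by (auto simp: is_generator_def)
    have "L (T t (A x)) = T t (L (A x))"
      by (rule tendsto_unique[OF _ lim[OF D] lim']) simp
    hence "A (L (T t (A x))) = - A (T t x)" by (simp add: L_A blinfun.minus_right)
    thus ?thesis using A_L[OF D] by simp
  qed
  have "extension_problem T A M D L"
  proof
    show "T 0 = id_blinfun" using C0 by (simp add: C0_semigroup_def)
    show "((\<lambda>t. (T t (A x) - A x) /\<^sub>R t) \<longlongrightarrow> - x) (at_right 0)" for x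
      using lim[OF A_in[of x]] by (simp add: L_A)
    show "(- A) x \<in> D" for x
      using A_in[of "- x"] by (simp add: blinfun.minus_left blinfun.minus_right)
    show "L ((- A) x) = x" for x
      using L_A[of "- x"] by (simp add: blinfun.minus_left blinfun.minus_right)
    show "(- A) (L x) = x" if "x \<in> D" for x
      using A_L[OF that] by (simp add: blinfun.minus_left)
  qed (use add M TA in auto)
  thus ?thesis by (rule that)
qed

theorem theorem4p1:
  fixes T :: "real \<Rightarrow> 'a::banach \<Rightarrow>\<^sub>L 'a"
    and D :: "'a set" and L :: "'a \<Rightarrow> 'a"
    and s :: real and u v :: "nat \<Rightarrow> 'a"
  assumes "C0_semigroup T"
    and "uniformly_bounded_semigroup T"
    and "is_generator D L T"
    and "0 \<in> resolvent_set D L"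
    and "s > 0" and "s \<notin> \<int>"
  shows "(\<forall>U W. classical_solution_higher_order D L s u v U \<longrightarrow>
                classical_solution_higher_order D L s u v W \<longrightarrow>
                (\<forall>y>0. U y = W y)) \<and>
         (\<forall>U W. classical_solution_second_order D L s u v U \<longrightarrow>
                classical_solution_second_order D L s u v W \<longrightarrow>
                (\<forall>y>0. U y = W y))"
proof -
  obtain A M where "extension_problem T A M D L"
    using extension_problem_generator[OF assms(1-4)] .
  then interpret extension_problem T A M D L .
  define n where "n = nat \<lfloor>s\<rfloor>"
  \<comment> \<open>Equivalent to \<open>1 - 2 * (s - n) > -1\<close>, the condition on the exponent
    in \<open>bessel_unique\<close>.\<close>
  have s: "s - n < 1"
    unfolding n_def using assms(5) real_of_int_floor_add_one_gt[of s] by linarith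
  show ?thesis
  proof (intro conjI allI impI)
    fix U W :: "real \<Rightarrow> 'a" and y :: real
    assume U: "classical_solution_higher_order D L s u v U"
      and W: "classical_solution_higher_order D L s u v W" and y: "y > 0"
    show "U y = W y"
      by (rule higher_order_unique[of n U W "1 - 2 * (s - real n)" u v])
        (use U W s y in \<open>simp_all add: classical_solution_higher_order_def Let_def
          flip: n_def del: funpow.simps, auto intro: regular_for_orderD\<close>)
  next
    fix U W :: "real \<Rightarrow> 'a" and y :: real
    assume "classical_solution_second_order D L s u v U"
      and "classical_solution_second_order D L s u v W" and y: "y > 0"
    hence sol: "classical_solution_second_order D L s u v X" if "X \<in> {U, W}" for X
      using that by blast
    note sol = sol[unfolded classical_solution_second_order_def Let_def, folded n_def]
    show "U y = W y"
    proof (rule second_order_unique[OF _ _ _ _ _ _ s y])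
      fix X assume X: "X \<in> {U, W}"
      have reg: "regular 1 X" using sol[OF X] regular_for_orderD by blast
      show "pos_differentiable 2 X" using regular_pos_differentiable[OF reg] by simp
      have "C_into_dom_pow (n + 1) D L 0 X" using sol[OF X] by blast
      from C_into_dom_powD[OF this] obtain F
        where "pos_differentiable (n + 1) F" "\<forall>y>0. X y = F y" by auto
      thus "pos_differentiable (Suc n) X" by (auto intro: pos_differentiable_cong)
      show "X y = - A (L (X y))" if "y > 0" for y
        using regular_in_domain[OF reg[unfolded One_nat_def] that] by (simp add: blinfun.minus_left)
      show "ext_op L (1 - 2 * s) X y = 0" if "y > 0" for y using sol[OF X] that by blast
    qed (use sol in blast)+
  qed
qed

end
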